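(* Let $E$ be an elliptic curve over $\mathbb{Q}$ that has a $\mathbb{Q}$-rational point of order $9$. Assume moreover that the conductor of $E$ is $N_E=p^{\alpha}q^{\beta}$, where $p\neq q$ are primes and $\alpha,\beta>0$ are integers. Then the minimal discriminant is $\Delta_E=-2^9\cdot 3^5$. In particular, $|\Delta_E|<N_E^5$, and Szpiro's conjecture holds for these curves: for every $\epsilon>0$ there is a constant $C_\epsilon$ such that $|\Delta_E|\le C_\epsilon N_E^{6+\epsilon}$ for every such $E$.
   Context: For an elliptic curve $E/\mathbb{Q}$, $\Delta_E$ denotes its minimal discriminant and $N_E$ its conductor. Szpiro's conjecture is the assertion that $|\Delta_E|\ll_{\epsilon}N_E^{6+\epsilon}$ for elliptic curves $E/\mathbb{Q}$. *)

theory Defs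
  imports
    Complex_Main
    "HOL-Computational_Algebra.Computational_Algebra"
    "HOL-Algebra.Algebraic_Closure_Type"
    "HOL-Algebra.Generated_Fields"
    "HOL-Algebra.Ideal_Product"
begin

section \<open>Weierstrass equations\<close>

text \<open>
  \<open>Weierstrass a1 a2 a3 a4 a6\<close> is the equation
  \<open>y^2 + a1 x y + a3 y = x^3 + a2 x^2 + a4 x + a6\<close>.
  Formulas are those of Silverman, The Arithmetic of Elliptic Curves (AEC), III.1 and III.2.
\<close>

datatype 'a weierstrass = Weierstrass 'a 'a 'a 'a 'a

datatype 'a point = Infinity | Affine 'a 'a

fun disc :: "'a::field weierstrass \<Rightarrow> 'a" where
  "disc (Weierstrass a1 a2 a3 a4 a6) =
    (let b2 = a1^2 + 4 * a2;
         b4 = 2 * a4 + a1 * a3;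
         b6 = a3^2 + 4 * a6;
         b8 = a1^2 * a6 + 4 * a2 * a6 - a1 * a3 * a4 + a2 * a3^2 - a4^2
     in - (b2^2) * b8 - 8 * b4^3 - 27 * b6^2 + 9 * b2 * b4 * b6)"

definition elliptic_curve :: "'a::field weierstrass \<Rightarrow> bool" where
  "elliptic_curve E \<longleftrightarrow> disc E \<noteq> 0"

fun on_curve :: "'a::field weierstrass \<Rightarrow> 'a point \<Rightarrow> bool" where
  "on_curve E Infinity \<longleftrightarrow> True"
| "on_curve (Weierstrass a1 a2 a3 a4 a6) (Affine x y) \<longleftrightarrow>
     y^2 + a1 * x * y + a3 * y = x^3 + a2 * x^2 + a4 * x + a6"

fun point_add :: "'a::field weierstrass \<Rightarrow> 'a point \<Rightarrow> 'a point \<Rightarrow> 'a point" where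
  "point_add E Infinity Q = Q"
| "point_add E (Affine x1 y1) Infinity = Affine x1 y1"
| "point_add (Weierstrass a1 a2 a3 a4 a6) (Affine x1 y1) (Affine x2 y2) =
    (if x1 = x2 \<and> y1 + y2 + a1 * x2 + a3 = 0 then Infinity
     else
       let l = (if x1 = x2
                then (3 * x1^2 + 2 * a2 * x1 + a4 - a1 * y1) / (2 * y1 + a1 * x1 + a3)
                else (y2 - y1) / (x2 - x1));
           n = y1 - l * x1;
           x3 = l^2 + a1 * l - a2 - x1 - x2
       in Affine x3 (- (l + a1) * x3 - n - a3))"

fun point_mult :: "'a::field weierstrass \<Rightarrow> nat \<Rightarrow> 'a point \<Rightarrow> 'a point" where
  "point_mult E 0 P = Infinity"
| "point_mult E (Suc n) P = point_add E P (point_mult E n P)"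

definition has_order :: "'a::field weierstrass \<Rightarrow> 'a point \<Rightarrow> nat \<Rightarrow> bool" where
  "has_order E P n \<longleftrightarrow>
     0 < n \<and> point_mult E n P = Infinity \<and> (\<forall>m. 0 < m \<and> m < n \<longrightarrow> point_mult E m P \<noteq> Infinity)"

text \<open>
  Two equations define isomorphic curves over the base field if they are related by a
  substitution \<open>x = u^2 x' + r\<close>, \<open>y = u^3 y' + u^2 s x' + t\<close> with \<open>u \<noteq> 0\<close>.
\<close>

fun curve_iso :: "'a::field weierstrass \<Rightarrow> 'a weierstrass \<Rightarrow> bool" where
  "curve_iso (Weierstrass a1 a2 a3 a4 a6) (Weierstrass a1' a2' a3' a4' a6') \<longleftrightarrow>
    (\<exists>u r s t. u \<noteq> 0 \<and>
       u * a1' = a1 + 2 * s \<and>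
       u^2 * a2' = a2 - s * a1 + 3 * r - s^2 \<and>
       u^3 * a3' = a3 + r * a1 + 2 * t \<and>
       u^4 * a4' = a4 - s * a3 + 2 * r * a2 - (t + r * s) * a1 + 3 * r^2 - 2 * s * t \<and>
       u^6 * a6' = a6 + r * a4 + r^2 * a2 + r^3 - t * a3 - t^2 - r * t * a1)"


section \<open>Minimal equations and the minimal discriminant\<close>

definition p_integral :: "nat \<Rightarrow> rat \<Rightarrow> bool" where
  "p_integral p x \<longleftrightarrow> \<not> int p dvd snd (quotient_of x)"

text \<open>For a \<open>p\<close>-integral \<open>x\<close>, this says that \<open>x\<close> reduces to \<open>0\<close> modulo \<open>p\<close>.\<close>

definition p_divides :: "nat \<Rightarrow> rat \<Rightarrow> bool" where
  "p_divides p x \<longleftrightarrow> int p dvd fst (quotient_of x)"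

text \<open>The \<open>p\<close>-adic valuation; only its values at nonzero arguments are meaningful.\<close>

definition p_val :: "nat \<Rightarrow> rat \<Rightarrow> int" where
  "p_val p x = int (multiplicity (int p) (fst (quotient_of x)))
             - int (multiplicity (int p) (snd (quotient_of x)))"

definition integral_at :: "nat \<Rightarrow> rat weierstrass \<Rightarrow> bool" where
  "integral_at p W \<longleftrightarrow> (\<forall>a\<in>set_weierstrass W. p_integral p a)"

definition minimal_model_at :: "nat \<Rightarrow> rat weierstrass \<Rightarrow> rat weierstrass \<Rightarrow> bool" where
  "minimal_model_at p E W \<longleftrightarrow>
     curve_iso E W \<and> integral_at p W \<and>
     (\<forall>W'. curve_iso E W' \<and> integral_at p W' \<longrightarrow> p_val p (disc W) \<le> p_val p (disc W'))"

definition global_minimal_model :: "rat weierstrass \<Rightarrow> rat weierstrass \<Rightarrow> bool" where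
  "global_minimal_model E W \<longleftrightarrow> (\<forall>p. prime p \<longrightarrow> minimal_model_at p E W)"

text \<open>
  Over the rationals a global minimal equation exists, and its discriminant is a (signed)
  integer that does not depend on the choice of the equation.
\<close>

definition min_disc :: "rat weierstrass \<Rightarrow> int" where
  "min_disc E = (THE D. \<exists>W. global_minimal_model E W \<and> disc W = of_int D)"


section \<open>Reduction types\<close>

definition good_reduction :: "nat \<Rightarrow> rat weierstrass \<Rightarrow> bool" where
  "good_reduction p E \<longleftrightarrow> (\<exists>W. minimal_model_at p E W \<and> \<not> p_divides p (disc W))"

text \<open>
  The reduction modulo \<open>p\<close> of a \<open>p\<close>-integral equation has a node. Since prime fields are
  perfect, a singular point of the reduced curve has coordinates in the prime field, so it is
  represented by integers \<open>x\<close>, \<open>y\<close>. The three divisibilities are the vanishing of the defining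
  polynomial and of its two partial derivatives at that point. The tangent cone there is
  \<open>Y^2 + a1 X Y - (3 x + a2) X^2\<close>, and it consists of two distinct lines over the algebraic
  closure iff \<open>T^2 + a1 T - (3 x + a2)\<close> has nonzero discriminant (in any characteristic).
\<close>

fun reduction_has_node :: "nat \<Rightarrow> rat weierstrass \<Rightarrow> bool" where
  "reduction_has_node p (Weierstrass a1 a2 a3 a4 a6) \<longleftrightarrow>
    (\<exists>x0 y0 :: int. let x = of_int x0; y = of_int y0 in
       p_divides p (y^2 + a1 * x * y + a3 * y - (x^3 + a2 * x^2 + a4 * x + a6)) \<and>
       p_divides p (a1 * y - (3 * x^2 + 2 * a2 * x + a4)) \<and>
       p_divides p (2 * y + a1 * x + a3) \<and>
       \<not> p_divides p (a1^2 + 4 * (3 * x + a2)))"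

text \<open>Bad reduction that is not multiplicative is additive: the reduced curve has a cusp.\<close>

definition multiplicative_reduction :: "nat \<Rightarrow> rat weierstrass \<Rightarrow> bool" where
  "multiplicative_reduction p E \<longleftrightarrow> (\<exists>W. minimal_model_at p E W \<and> reduction_has_node p W)"


section \<open>The wild part of the conductor\<close>

abbreviation complex_ring :: "complex ring" where
  "complex_ring \<equiv> ring_of_type_algebra"

definition torsion :: "rat weierstrass \<Rightarrow> nat \<Rightarrow> complex point set" where
  "torsion E l = {Q. on_curve (map_weierstrass of_rat E) Q \<and>
                     point_mult (map_weierstrass of_rat E) l Q = Infinity}"

text \<open>The field of definition \<open>\<rat>(E[l])\<close> of the \<open>l\<close>-torsion, as a subfield of the complex numbers.\<close>

definition division_field :: "rat weierstrass \<Rightarrow> nat \<Rightarrow> complex set" where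
  "division_field E l = generate_field complex_ring (\<Union>Q\<in>torsion E l. set_point Q)"

definition ring_of_integers :: "complex set \<Rightarrow> complex ring" where
  "ring_of_integers L = complex_ring\<lparr>carrier := {x \<in> L. algebraic_int x}\<rparr>"

text \<open>
  Field automorphisms of \<open>L\<close> (automatically fixing the rationals); \<open>extensional\<close> makes an
  automorphism of \<open>L\<close> a unique function on the complex numbers.
\<close>

definition galois_group :: "complex set \<Rightarrow> (complex \<Rightarrow> complex) set" where
  "galois_group L =
     ring_iso (complex_ring\<lparr>carrier := L\<rparr>) (complex_ring\<lparr>carrier := L\<rparr>) \<inter> extensional L"

definition prime_above :: "complex set \<Rightarrow> nat \<Rightarrow> complex set \<Rightarrow> bool" where
  "prime_above L p I \<longleftrightarrow> primeideal I (ring_of_integers L) \<and> of_nat p \<in> I"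

text \<open>
  The ramification group \<open>G\<^sub>i\<close> in lower numbering at the prime \<open>I\<close>: the automorphisms acting
  trivially on the integers modulo the power \<open>I^(i+1)\<close>. For \<open>L\<close> Galois over the rationals it is
  identified with the \<open>i\<close>-th ramification group of the completion of \<open>L\<close> at \<open>I\<close> over the
  \<open>p\<close>-adic numbers.
\<close>

definition ramification_group :: "complex set \<Rightarrow> complex set \<Rightarrow> nat \<Rightarrow> (complex \<Rightarrow> complex) set" where
  "ramification_group L I i =
     {\<sigma> \<in> galois_group L. \<forall>x \<in> carrier (ring_of_integers L).
        \<sigma> x - x \<in> ((\<lambda>J. ideal_prod (ring_of_integers L) I J) ^^ i) I}"

definition fixed_torsion ::
  "rat weierstrass \<Rightarrow> nat \<Rightarrow> (complex \<Rightarrow> complex) set \<Rightarrow> complex point set" where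
  "fixed_torsion E l G = {Q \<in> torsion E l. \<forall>\<sigma>\<in>G. map_point \<sigma> Q = Q}"

text \<open>
  The wild part of the exponent of the conductor (Silverman, Advanced Topics in the Arithmetic
  of Elliptic Curves (ATAEC), IV.10):
  the sum over \<open>i \<ge> 1\<close> of \<open>(#G\<^sub>i / #G\<^sub>0) dim (E[l] / E[l]^(G\<^sub>i))\<close>, where \<open>l \<noteq> p\<close> is a prime and
  the dimension, over the field with \<open>l\<close> elements, is the logarithm to the base \<open>l\<close> of the
  number of elements. All but finitely many terms vanish, and the value depends neither on \<open>l\<close>
  nor on the prime \<open>I\<close> above \<open>p\<close>.
\<close>

definition wild_sum :: "nat \<Rightarrow> rat weierstrass \<Rightarrow> nat \<Rightarrow> complex set \<Rightarrow> real" where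
  "wild_sum l E p I =
     (let G = ramification_group (division_field E l) I in
      \<Sum>j. let i = Suc j in
        real (card (G i)) / real (card (G 0)) *
        log (real l) (real (card (torsion E l)) / real (card (fixed_torsion E l (G i)))))"

text \<open>The wild sum is known to be a natural number, so that \<open>\<lfloor>_\<rfloor>\<close> only changes the type.\<close>

definition wild_exponent :: "nat \<Rightarrow> rat weierstrass \<Rightarrow> nat" where
  "wild_exponent p E =
     (let l = (if p = 2 then 3 else 2);
          I = (SOME I. prime_above (division_field E l) p I)
      in nat \<lfloor>wild_sum l E p I\<rfloor>)"


section \<open>The conductor\<close>

definition conductor_exponent :: "nat \<Rightarrow> rat weierstrass \<Rightarrow> nat" where
  "conductor_exponent p E =
     (if good_reduction p E then 0
      else if multiplicative_reduction p E then 1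
      else 2 + wild_exponent p E)"

definition conductor :: "rat weierstrass \<Rightarrow> nat" where
  "conductor E = (\<Prod>p | prime p \<and> \<not> good_reduction p E. p ^ conductor_exponent p E)"


section \<open>The curves under consideration\<close>

definition order9_two_prime_curve :: "rat weierstrass \<Rightarrow> bool" where
  "order9_two_prime_curve E \<longleftrightarrow>
     elliptic_curve E \<and>
     (\<exists>P. on_curve E P \<and> has_order E P 9) \<and>
     (\<exists>p q \<alpha> \<beta> :: nat. prime p \<and> prime q \<and> p \<noteq> q \<and> 0 < \<alpha> \<and> 0 < \<beta> \<and>
        conductor E = p ^ \<alpha> * q ^ \<beta>)"

end

theory Submission
  imports Defs
begin

text \<open>
  By Kubert's parametrization, a curve with a rational point of order 9 has, for some coprime
  \<open>m\<close> and \<open>n\<close>, an integral equation with discriminant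
  \<open>(m n (m - n))^9 k^3 (m^3 - 6 m^2 n + 3 m n^2 + n^3)\<close>, where \<open>k = m^2 - m n + n^2\<close>.
  All primes dividing \<open>m n (m - n) k\<close> are bad: they do not divide \<open>c4\<close>, except that for 3
  dividing \<open>k\<close> the discriminant has 3-adic valuation 5. Now \<open>k > 1\<close> is prime to
  the even number \<open>m n (m - n)\<close>, so if only two primes are bad, the latter is up to sign a
  power of 2. This leaves three pairs \<open>(m, n)\<close>, all of them with discriminant
  \<open>- 2^9 3^5\<close>, which is minimal as no valuation reaches 12. The reduction at 3 is
  additive because 3 divides \<open>c4\<close>; hence 18 divides the conductor, and
  \<open>2^9 3^5 < 18^5\<close>.
\<close>

section \<open>Valuations\<close>

lemma quotient_of_props:
  obtains a b where "quotient_of x = (a, b)" "b > 0" "coprime a b" "x = of_int a / of_int b"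
  by (metis quotient_of_coprime quotient_of_denom_pos quotient_of_div surj_pair)

text \<open>\<open>p_val\<close> is defined through the reduced fraction. Cross-multiplication frees
  it from lowest terms, which is what multiplicativity needs.\<close>

lemma p_val_of_int_divide:
  assumes "prime p" "a \<noteq> 0" "b \<noteq> 0"
  shows "p_val p (of_int a / of_int b) =
    int (multiplicity (int p) a) - int (multiplicity (int p) b)"
proof -
  obtain c d where cd: "quotient_of (of_int a / of_int b) = (c, d)" "d > 0"
    "(of_int a / of_int b :: rat) = of_int c / of_int d"
    by (rule quotient_of_props)
  from cd(2,3) assms have "of_int (a * d) = (of_int (c * b) :: rat)"
    by (simp add: field_simps)
  hence eq: "a * d = c * b"
    by (simp only: of_int_eq_iff)
  with assms cd(2) have "c \<noteq> 0" by auto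
  have "multiplicity (int p) a + multiplicity (int p) d
      = multiplicity (int p) c + multiplicity (int p) b"
    using arg_cong[OF eq, of "multiplicity (int p)"] assms cd(2) \<open>c \<noteq> 0\<close>
    by (simp add: prime_elem_multiplicity_mult_distrib)
  thus ?thesis
    by (simp add: p_val_def cd(1))
qed

lemma p_val_of_int:
  "prime p \<Longrightarrow> a \<noteq> 0 \<Longrightarrow> p_val p (of_int a) = int (multiplicity (int p) a)"
  using p_val_of_int_divide[of p a 1] by simp

lemma p_val_mult:
  assumes "prime p" "x \<noteq> 0" "y \<noteq> 0"
  shows "p_val p (x * y) = p_val p x + p_val p y"
proof -
  obtain a b where ab: "b > 0" "x = of_int a / of_int b" by (rule quotient_of_props)
  obtain c d where cd: "d > 0" "y = of_int c / of_int d" by (rule quotient_of_props)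
  have nz: "a \<noteq> 0" "b \<noteq> 0" "c \<noteq> 0" "d \<noteq> 0" using ab cd assms by auto
  have "x * y = of_int (a * c) / of_int (b * d)" using ab cd by simp
  hence "p_val p (x * y) =
      int (multiplicity (int p) (a * c)) - int (multiplicity (int p) (b * d))"
    using p_val_of_int_divide[of p "a * c" "b * d"] assms(1) nz by simp
  also have "\<dots> = p_val p x + p_val p y"
    using assms(1) nz
    by (simp add: ab(2) cd(2) p_val_of_int_divide prime_elem_multiplicity_mult_distrib)
  finally show ?thesis .
qed

lemma p_val_power:
  assumes "prime p" "x \<noteq> 0"
  shows "p_val p (x ^ n) = int n * p_val p x"
proof (induction n)
  case 0
  show ?case using p_val_of_int[of p 1] assms by simp
next
  case (Suc n)
  thus ?case using assms by (simp add: p_val_mult algebra_simps)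
qed

lemma p_integral_iff_p_val:
  assumes "prime p" "x \<noteq> 0"
  shows "p_integral p x \<longleftrightarrow> p_val p x \<ge> 0"
proof -
  obtain a b where ab: "quotient_of x = (a, b)" "b > 0" "coprime a b" "x = of_int a / of_int b"
    by (rule quotient_of_props)
  have p: "prime (int p)" using assms(1) by simp
  show ?thesis
  proof (cases "int p dvd b")
    case True
    hence "\<not> int p dvd a"
      using ab(3) p by (meson coprime_common_divisor not_prime_unit)
    hence "multiplicity (int p) a = 0" by (rule not_dvd_imp_multiplicity_0)
    moreover have "multiplicity (int p) b > 0"
      using True ab(2) p by (simp add: prime_multiplicity_gt_zero_iff)
    ultimately show ?thesis using True by (simp add: p_integral_def p_val_def ab(1))
  next
    case False
    thus ?thesis by (simp add: p_integral_def p_val_def ab(1) not_dvd_imp_multiplicity_0)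
  qed
qed

lemma p_divides_iff_p_val:
  assumes "prime p" "x \<noteq> 0"
  shows "p_divides p x \<longleftrightarrow> p_val p x > 0"
proof -
  obtain a b where ab: "quotient_of x = (a, b)" "b > 0" "coprime a b" "x = of_int a / of_int b"
    by (rule quotient_of_props)
  have p: "prime (int p)" using assms(1) by simp
  have "a \<noteq> 0" using ab assms by auto
  show ?thesis
  proof (cases "int p dvd a")
    case True
    hence "\<not> int p dvd b"
      using ab(3) p by (meson coprime_common_divisor not_prime_unit)
    hence "multiplicity (int p) b = 0" by (rule not_dvd_imp_multiplicity_0)
    moreover have "multiplicity (int p) a > 0"
      using True \<open>a \<noteq> 0\<close> p by (simp add: prime_multiplicity_gt_zero_iff)
    ultimately show ?thesis using True by (simp add: p_divides_def p_val_def ab(1))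
  next
    case False
    thus ?thesis by (simp add: p_divides_def p_val_def ab(1) not_dvd_imp_multiplicity_0)
  qed
qed

text \<open>Dropping lowest terms makes closure under sums and products immediate: only the product
  of the two denominators has to stay prime to \<open>p\<close>.\<close>

lemma p_integral_iff_fraction:
  assumes "prime p"
  shows "p_integral p x \<longleftrightarrow> (\<exists>a b. \<not> int p dvd b \<and> x = of_int a / of_int b)"
proof
  show "\<exists>a b. \<not> int p dvd b \<and> x = of_int a / of_int b" if "p_integral p x"
    using that by (metis p_integral_def quotient_of_props snd_conv)
next
  assume "\<exists>a b. \<not> int p dvd b \<and> x = of_int a / of_int b"
  then obtain a b where ab: "\<not> int p dvd b" "x = of_int a / of_int b" by blast
  show "p_integral p x"
  proof (cases "x = 0")
    case True
    thus ?thesis using assms by (auto simp: p_integral_def prime_nat_iff)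
  next
    case False
    hence nz: "a \<noteq> 0" "b \<noteq> 0" using ab by auto
    show ?thesis
      using p_val_of_int_divide[OF assms nz] not_dvd_imp_multiplicity_0[OF ab(1)] False ab(2)
      by (simp add: p_integral_iff_p_val[OF assms])
  qed
qed

text \<open>Identifies \<open>p_divides\<close> with membership in the ideal generated by
  \<open>p\<close> in the ring of \<open>p\<close>-integral rationals.\<close>

lemma p_divides_iff_multiple:
  assumes p: "prime p"
  shows "p_divides p x \<longleftrightarrow> (\<exists>y. p_integral p y \<and> x = of_nat p * y)"
proof (cases "x = 0")
  case True
  have "p_integral p 0" using p by (auto simp: p_integral_def prime_nat_iff)
  thus ?thesis using True by (auto simp: p_divides_def intro!: exI[of _ 0])
next
  case False
  have "p > 0" using p by (rule prime_gt_0_nat)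
  have "p_val p (of_nat p) = 1"
    using p_val_of_int[OF p, of "int p"] p by simp
  hence val: "p_val p x = 1 + p_val p (x / of_nat p)"
    using p_val_mult[OF p, of "of_nat p" "x / of_nat p"] False \<open>p > 0\<close> by simp
  have "(\<exists>y. p_integral p y \<and> x = of_nat p * y) \<longleftrightarrow> p_integral p (x / of_nat p)"
    using \<open>p > 0\<close> by (auto intro!: exI[of _ "x / of_nat p"])
  thus ?thesis
    using val False \<open>p > 0\<close> by (auto simp: p_divides_iff_p_val[OF p] p_integral_iff_p_val[OF p])
qed

section \<open>The \<open>p\<close>-integral rationals as a subring\<close>

lemma p_integral_of_int [simp]: "prime p \<Longrightarrow> p_integral p (of_int a)"
  by (auto simp: p_integral_def quotient_of_int prime_nat_iff)

lemma p_integral_mult: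
  assumes "prime p" "p_integral p x" "p_integral p y"
  shows "p_integral p (x * y)"
proof -
  obtain a b where ab: "\<not> int p dvd b" "x = of_int a / of_int b"
    using assms p_integral_iff_fraction by blast
  obtain c d where cd: "\<not> int p dvd d" "y = of_int c / of_int d"
    using assms p_integral_iff_fraction by blast
  have "\<not> int p dvd b * d" using ab cd assms(1) by (simp add: prime_dvd_mult_iff)
  moreover have "x * y = of_int (a * c) / of_int (b * d)" using ab cd by simp
  ultimately show ?thesis using assms(1) p_integral_iff_fraction by blast
qed

lemma p_integral_add:
  assumes "prime p" "p_integral p x" "p_integral p y"
  shows "p_integral p (x + y)"
proof -
  obtain a b where ab: "\<not> int p dvd b" "x = of_int a / of_int b"
    using assms p_integral_iff_fraction by blast
  obtain c d where cd: "\<not> int p dvd d" "y = of_int c / of_int d"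
    using assms p_integral_iff_fraction by blast
  have "\<not> int p dvd b * d" using ab cd assms(1) by (simp add: prime_dvd_mult_iff)
  moreover have "b \<noteq> 0" "d \<noteq> 0" using ab cd by auto
  hence "x + y = of_int (a * d + c * b) / of_int (b * d)" using ab cd by (simp add: field_simps)
  ultimately show ?thesis using assms(1) p_integral_iff_fraction by blast
qed

lemma p_integral_uminus: "prime p \<Longrightarrow> p_integral p x \<Longrightarrow> p_integral p (- x)"
  using p_integral_mult[of p "of_int (-1)" x] p_integral_of_int[of p "-1"] by simp

lemma p_integral_diff:
  "prime p \<Longrightarrow> p_integral p x \<Longrightarrow> p_integral p y \<Longrightarrow> p_integral p (x - y)"
  using p_integral_add[of p x "- y"] by (simp add: p_integral_uminus)

lemma p_integral_power: "prime p \<Longrightarrow> p_integral p x \<Longrightarrow> p_integral p (x ^ n)"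
  by (induction n) (simp_all add: p_integral_mult p_integral_of_int[of p 1, simplified])

lemma p_integral_numeral: "prime p \<Longrightarrow> p_integral p (numeral k)"
  using p_integral_of_int[of p "numeral k"] by simp

lemmas p_integral_intros = p_integral_add p_integral_mult p_integral_diff p_integral_uminus
  p_integral_power p_integral_numeral

section \<open>Change of coordinates\<close>

text \<open>This is c4 = b2^2 - 24 b4. It separates nodes from cusps and scales with weight 4,
  against weight 12 for the discriminant.\<close>

fun c4_invariant :: "'a::field weierstrass \<Rightarrow> 'a" where
  "c4_invariant (Weierstrass a1 a2 a3 a4 a6) = (a1^2 + 4 * a2)^2 - 24 * (2 * a4 + a1 * a3)"

lemma p_integral_disc: "prime p \<Longrightarrow> integral_at p W \<Longrightarrow> p_integral p (disc W)"
  by (cases W) (auto simp: integral_at_def Let_def intro!: p_integral_intros)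

lemma p_integral_c4: "prime p \<Longrightarrow> integral_at p W \<Longrightarrow> p_integral p (c4_invariant W)"
  by (cases W) (auto simp: integral_at_def intro!: p_integral_intros)

text \<open>The body of \<open>curve_iso\<close> with the parameters exposed, so that the scaling
  \<open>u\<close> can be tracked and the substitution applied to points.\<close>

fun is_transform :: "'a::field \<Rightarrow> 'a \<Rightarrow> 'a \<Rightarrow> 'a \<Rightarrow> 'a weierstrass \<Rightarrow> 'a weierstrass \<Rightarrow> bool" where
  "is_transform u r s t (Weierstrass a1 a2 a3 a4 a6) (Weierstrass a1' a2' a3' a4' a6') \<longleftrightarrow>
       u \<noteq> 0 \<and>
       u * a1' = a1 + 2 * s \<and>
       u^2 * a2' = a2 - s * a1 + 3 * r - s^2 \<and>
       u^3 * a3' = a3 + r * a1 + 2 * t \<and>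
       u^4 * a4' = a4 - s * a3 + 2 * r * a2 - (t + r * s) * a1 + 3 * r^2 - 2 * s * t \<and>
       u^6 * a6' = a6 + r * a4 + r^2 * a2 + r^3 - t * a3 - t^2 - r * t * a1"

lemma curve_iso_iff_transform: "curve_iso E W \<longleftrightarrow> (\<exists>u r s t. is_transform u r s t E W)"
  by (cases E; cases W) simp

text \<open>The quantities b2, b4, b6, b8 depend on the substitution through \<open>u\<close> and
  \<open>r\<close> only. Each is multiplied by its power of \<open>u\<close> so that the defining
  equations can be used as rewrite rules.\<close>

lemma transform_invariants:
  fixes u :: "'a::field"
  assumes "is_transform u r s t E W"
  shows "u ^ 4 * c4_invariant W = c4_invariant E" and "u ^ 12 * disc W = disc E"
proof -
  obtain a1 a2 a3 a4 a6 where E: "E = Weierstrass a1 a2 a3 a4 a6" by (cases E)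
  obtain a1' a2' a3' a4' a6' where W: "W = Weierstrass a1' a2' a3' a4' a6'" by (cases W)
  have tr: "u * a1' = a1 + 2 * s" "u^2 * a2' = a2 - s * a1 + 3 * r - s^2"
    "u^3 * a3' = a3 + r * a1 + 2 * t"
    "u^4 * a4' = a4 - s * a3 + 2 * r * a2 - (t + r * s) * a1 + 3 * r^2 - 2 * s * t"
    "u^6 * a6' = a6 + r * a4 + r^2 * a2 + r^3 - t * a3 - t^2 - r * t * a1"
    using assms by (simp_all add: E W)
  define b2 b4 b6 b8 where "b2 = a1^2 + 4 * a2" and "b4 = 2 * a4 + a1 * a3"
    and "b6 = a3^2 + 4 * a6"
    and "b8 = a1^2 * a6 + 4 * a2 * a6 - a1 * a3 * a4 + a2 * a3^2 - a4^2"
  note b = b2_def b4_def b6_def b8_def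
  define b2' b4' b6' b8' where "b2' = a1'^2 + 4 * a2'" and "b4' = 2 * a4' + a1' * a3'"
    and "b6' = a3'^2 + 4 * a6'"
    and "b8' = a1'^2 * a6' + 4 * a2' * a6' - a1' * a3' * a4' + a2' * a3'^2 - a4'^2"
  note b' = b2'_def b4'_def b6'_def b8'_def
  have "u^2 * b2' = (u * a1')^2 + 4 * (u^2 * a2')"
    by (simp add: b' algebra_simps power2_eq_square)
  also have "\<dots> = b2 + 12 * r"
    by (simp only: tr b) (simp add: algebra_simps power2_eq_square)
  finally have e2: "u^2 * b2' = b2 + 12 * r" .
  have "u^4 * b4' = 2 * (u^4 * a4') + (u * a1') * (u^3 * a3')"
    by (simp add: b' algebra_simps eval_nat_numeral)
  also have "\<dots> = b4 + r * b2 + 6 * r^2"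
    by (simp only: tr b) (simp add: algebra_simps power2_eq_square)
  finally have e4: "u^4 * b4' = b4 + r * b2 + 6 * r^2" .
  have "u^6 * b6' = (u^3 * a3')^2 + 4 * (u^6 * a6')"
    by (simp add: b' algebra_simps eval_nat_numeral)
  also have "\<dots> = b6 + 2 * r * b4 + r^2 * b2 + 4 * r^3"
    by (simp only: tr b) (simp add: algebra_simps eval_nat_numeral)
  finally have e6: "u^6 * b6' = b6 + 2 * r * b4 + r^2 * b2 + 4 * r^3" .
  have "u^8 * b8' = (u * a1')^2 * (u^6 * a6') + 4 * (u^2 * a2') * (u^6 * a6')
      - (u * a1') * (u^3 * a3') * (u^4 * a4') + (u^2 * a2') * (u^3 * a3')^2 - (u^4 * a4')^2"
    by (simp add: b' algebra_simps eval_nat_numeral)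
  also have "\<dots> = b8 + 3 * r * b6 + 3 * r^2 * b4 + r^3 * b2 + 3 * r^4"
    by (simp only: tr b) (simp add: algebra_simps eval_nat_numeral)
  finally have e8: "u^8 * b8' = b8 + 3 * r * b6 + 3 * r^2 * b4 + r^3 * b2 + 3 * r^4" .
  have rel: "4 * b8 = b2 * b6 - b4^2"
    by (simp add: b algebra_simps eval_nat_numeral)
  have "u^4 * (b2'^2 - 24 * b4') = (u^2 * b2')^2 - 24 * (u^4 * b4')"
    by (simp add: algebra_simps eval_nat_numeral)
  also have "\<dots> = b2^2 - 24 * b4"
    by (simp only: e2 e4) (simp add: algebra_simps power2_eq_square)
  finally show "u ^ 4 * c4_invariant W = c4_invariant E"
    by (simp add: E W b b')
  have "u^12 * (- (b2'^2) * b8' - 8 * b4'^3 - 27 * b6'^2 + 9 * b2' * b4' * b6') =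
     - ((u^2 * b2')^2) * (u^8 * b8') - 8 * (u^4 * b4')^3 - 27 * (u^6 * b6')^2
     + 9 * (u^2 * b2') * (u^4 * b4') * (u^6 * b6')"
    by (simp add: algebra_simps eval_nat_numeral)
  \<comment> \<open>For independent b2, b4, b6, b8 the discriminant is not invariant under the shift
    by \<open>r\<close>; the error is a multiple of the relation \<open>rel\<close>.\<close>
  also have "\<dots> = - (b2^2) * b8 - 8 * b4^3 - 27 * b6^2 + 9 * b2 * b4 * b6
      - (4 * b8 - (b2 * b6 - b4^2)) * (6 * r * b2 + 36 * r^2)"
    by (simp only: e2 e4 e6 e8) (simp add: algebra_simps eval_nat_numeral)
  also have "\<dots> = - (b2^2) * b8 - 8 * b4^3 - 27 * b6^2 + 9 * b2 * b4 * b6"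
    by (simp add: rel)
  finally show "u ^ 12 * disc W = disc E"
    by (simp add: E W b b' Let_def)
qed

lemma is_transform_rescale:
  assumes "is_transform u r s t E (Weierstrass (v * a1) (v^2 * a2) (v^3 * a3) (v^4 * a4) (v^6 * a6))"
    and "v \<noteq> 0"
  shows "is_transform (u * v) r s t E (Weierstrass a1 a2 a3 a4 a6)"
  using assms by (cases E) (simp add: power_mult_distrib mult.assoc)

section \<open>Substitutions acting on points, from the new equation back to the old one\<close>

fun transform_point :: "'a::field \<Rightarrow> 'a \<Rightarrow> 'a \<Rightarrow> 'a \<Rightarrow> 'a point \<Rightarrow> 'a point" where
  "transform_point u r s t Infinity = Infinity"
| "transform_point u r s t (Affine x y) = Affine (u^2 * x + r) (u^3 * y + u^2 * s * x + t)"

lemma transform_point_eq_Infinity [simp]: "transform_point u r s t P = Infinity \<longleftrightarrow> P = Infinity"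
  by (cases P) auto

text \<open>
  The nonvanishing assumption excludes the junk value \<open>l = 0\<close> that the formula of
  \<open>point_add\<close> yields when the tangent at the first point is vertical and the second point
  has the same abscissa but is off the curve.
\<close>

lemma transform_point_add:
  fixes u :: "'a::field"
  assumes tr: "is_transform u r s t E (Weierstrass a1' a2' a3' a4' a6')"
    and nonvert: "2 * x2 + a1' * x1 + a3' \<noteq> 0"
  shows "point_add E (transform_point u r s t (Affine x1 x2)) (transform_point u r s t Q) =
    transform_point u r s t (point_add (Weierstrass a1' a2' a3' a4' a6') (Affine x1 x2) Q)"
proof (cases Q)
  case Infinity
  thus ?thesis by simp
next
  case (Affine z1 z2)
  obtain a1 a2 a3 a4 a6 where E: "E = Weierstrass a1 a2 a3 a4 a6" by (cases E)
  have u: "u \<noteq> 0" and "u * a1' = a1 + 2 * s" "u^2 * a2' = a2 - s * a1 + 3 * r - s^2"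
    "u^3 * a3' = a3 + r * a1 + 2 * t"
    "u^4 * a4' = a4 - s * a3 + 2 * r * a2 - (t + r * s) * a1 + 3 * r^2 - 2 * s * t"
    using tr by (simp_all add: E)
  hence a: "a1 = u * a1' - 2 * s" "a2 = u^2 * a2' + s * a1 - 3 * r + s^2"
    "a3 = u^3 * a3' - r * a1 - 2 * t"
    "a4 = u^4 * a4' + s * a3 - 2 * r * a2 + (t + r * s) * a1 - 3 * r^2 + 2 * s * t"
    by simp_all
  define X1 X2 Z1 Z2 where "X1 = u^2 * x1 + r" and "X2 = u^3 * x2 + u^2 * s * x1 + t"
    and "Z1 = u^2 * z1 + r" and "Z2 = u^3 * z2 + u^2 * s * z1 + t"
  note defs = X1_def X2_def Z1_def Z2_def
  have eq_iff: "X1 = Z1 \<longleftrightarrow> x1 = z1" using u by (simp add: defs)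
  have "X2 + Z2 + a1 * Z1 + a3 = u^3 * (x2 + z2 + a1' * z1 + a3')" if "x1 = z1"
    unfolding a defs using that by (simp add: algebra_simps eval_nat_numeral)
  hence neg_iff: "X1 = Z1 \<and> X2 + Z2 + a1 * Z1 + a3 = 0 \<longleftrightarrow>
      x1 = z1 \<and> x2 + z2 + a1' * z1 + a3' = 0"
    using u eq_iff by auto
  define l where "l = (if x1 = z1
    then (3 * x1^2 + 2 * a2' * x1 + a4' - a1' * x2) / (2 * x2 + a1' * x1 + a3')
    else (z2 - x2) / (z1 - x1))"
  define L where "L = (if X1 = Z1
    then (3 * X1^2 + 2 * a2 * X1 + a4 - a1 * X2) / (2 * X2 + a1 * X1 + a3)
    else (Z2 - X2) / (Z1 - X1))"
  \<comment> \<open>From y = u^3 y' + u^2 s x' + t and x = u^2 x' + r, slopes of chords and tangents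
    transform by l \<mapsto> u l + s.\<close>
  have L: "L = u * l + s"
  proof (cases "x1 = z1")
    case True
    have den: "2 * X2 + a1 * X1 + a3 = u^3 * (2 * x2 + a1' * x1 + a3')"
      unfolding a defs by (simp add: algebra_simps eval_nat_numeral)
    have num: "3 * X1^2 + 2 * a2 * X1 + a4 - a1 * X2 =
       u^4 * (3 * x1^2 + 2 * a2' * x1 + a4' - a1' * x2) + s * u^3 * (2 * x2 + a1' * x1 + a3')"
      unfolding a defs by (simp add: algebra_simps eval_nat_numeral)
    have frac: "(u^4 * N + s * u^3 * D) / (u^3 * D) = u * (N / D) + s" if "D \<noteq> 0" for N D
      using u that by (simp add: add_divide_distrib eval_nat_numeral)
    have eq: "X1 = Z1" using eq_iff True by simp
    show ?thesis
      unfolding L_def l_def if_P[OF True] if_P[OF eq] num den by (rule frac[OF nonvert])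
  next
    case False
    have "Z2 - X2 = u^3 * (z2 - x2) + s * u^2 * (z1 - x1)" "Z1 - X1 = u^2 * (z1 - x1)"
      unfolding defs by (simp_all add: algebra_simps)
    thus ?thesis
      using False u eq_iff unfolding L_def l_def
      by (simp add: add_divide_distrib eval_nat_numeral)
  qed
  define w where "w = l^2 + a1' * l - a2' - x1 - z1"
  define V where "V = L^2 + a1 * L - a2 - X1 - Z1"
  have V: "V = u^2 * w + r"
    unfolding V_def w_def L a defs by (simp add: algebra_simps eval_nat_numeral)
  have y: "- (L + a1) * V - (X2 - L * X1) - a3 =
      u^3 * (- (l + a1') * w - (x2 - l * x1) - a3') + u^2 * s * w + t"
    unfolding V L a defs by (simp add: algebra_simps eval_nat_numeral)
  have lhs: "point_add E (Affine X1 X2) (Affine Z1 Z2) =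
      (if X1 = Z1 \<and> X2 + Z2 + a1 * Z1 + a3 = 0 then Infinity
       else Affine V (- (L + a1) * V - (X2 - L * X1) - a3))"
    by (simp add: E V_def L_def Let_def)
  have rhs: "point_add (Weierstrass a1' a2' a3' a4' a6') (Affine x1 x2) (Affine z1 z2) =
      (if x1 = z1 \<and> x2 + z2 + a1' * z1 + a3' = 0 then Infinity
       else Affine w (- (l + a1') * w - (x2 - l * x1) - a3'))"
    by (simp add: w_def l_def Let_def)
  show ?thesis
    unfolding Affine transform_point.simps defs[symmetric] lhs rhs neg_iff
    using V y by simp
qed

lemma transform_point_mult:
  assumes "is_transform u r s t E (Weierstrass a1 a2 a3 a4 a6)" "2 * y + a1 * x + a3 \<noteq> 0"
  shows "point_mult E n (transform_point u r s t (Affine x y)) =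
    transform_point u r s t (point_mult (Weierstrass a1 a2 a3 a4 a6) n (Affine x y))"
  by (induction n)
    (simp_all add: transform_point_add[OF assms, simplified transform_point.simps])

lemma transform_has_order:
  assumes "is_transform u r s t E (Weierstrass a1 a2 a3 a4 a6)" "2 * y + a1 * x + a3 \<noteq> 0"
  shows "has_order E (transform_point u r s t (Affine x y)) n \<longleftrightarrow>
    has_order (Weierstrass a1 a2 a3 a4 a6) (Affine x y) n"
  unfolding has_order_def transform_point_mult[OF assms] by simp

section \<open>Kubert's parametrization\<close>

fun point_neg :: "'a::field weierstrass \<Rightarrow> 'a point \<Rightarrow> 'a point" where
  "point_neg E Infinity = Infinity"
| "point_neg (Weierstrass a1 a2 a3 a4 a6) (Affine x y) = Affine x (- y - a1 * x - a3)"

lemma origin_add_Affine: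
  fixes x :: "'a::field"
  assumes "x \<noteq> 0"
  shows "point_add (Weierstrass a1 a2 a3 0 0) (Affine 0 0) (Affine x y) =
    Affine ((y / x)^2 + a1 * (y / x) - a2 - x)
      (- (y / x + a1) * ((y / x)^2 + a1 * (y / x) - a2 - x) - a3)"
  using assms by (simp add: Let_def)

text \<open>A cancellation law that takes the place of associativity. With a4 = a6 = 0, the line
  through the origin and an affine \<open>Q\<close> off the y-axis is y = l x, and its third point
  is the negative of the sum, so \<open>Q\<close> and that third point play symmetric roles.\<close>

lemma origin_add:
  fixes a1 a2 a3 :: "'a::field"
  assumes a3: "a3 \<noteq> 0" and W: "W = Weierstrass a1 a2 a3 0 0" and Q: "on_curve W Q"
  shows on_curve_origin_add: "on_curve W (point_add W (Affine 0 0) Q)"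
    and origin_add_cancel:
      "point_add W (Affine 0 0) (point_neg W (point_add W (Affine 0 0) Q)) = point_neg W Q"
proof -
  have "on_curve W (point_add W (Affine 0 0) Q) \<and>
    point_add W (Affine 0 0) (point_neg W (point_add W (Affine 0 0) Q)) = point_neg W Q"
  proof (cases Q)
    case Infinity
    thus ?thesis by (simp add: W)
  next
    case (Affine x y)
    have curve: "y^2 + a1 * x * y + a3 * y = x^3 + a2 * x^2"
      using Q by (simp add: W Affine)
    show ?thesis
    proof (cases "x = 0")
      case True
      have "y * (y + a3) = 0"
        using curve True by (simp add: algebra_simps power2_eq_square)
      hence "y = 0 \<or> y = - a3" by (simp add: eq_neg_iff_add_eq_0)
      thus ?thesis
        using a3 True Affine W by (auto simp: Let_def algebra_simps eval_nat_numeral)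
    next
      case False
      define l where "l = y / x"
      define z where "z = l^2 + a1 * l - a2 - x"
      have y: "y = l * x" using False by (simp add: l_def)
      have add: "point_add W (Affine 0 0) Q = Affine z (- (l + a1) * z - a3)"
        using origin_add_Affine[OF False] by (simp add: W Affine l_def z_def)
      have neg: "point_neg W (Affine z (- (l + a1) * z - a3)) = Affine z (l * z)"
        by (simp add: W algebra_simps)
      \<comment> \<open>Vieta: the line y = l x meets the cubic at the abscissas 0, \<open>x\<close>
        and \<open>z\<close>, and after division by the factor for 0 the constant term is
        \<open>- a3 * l\<close>.\<close>
      have "x * (x * z) = x * (- a3 * l)"
        using curve unfolding y z_def by (simp add: algebra_simps eval_nat_numeral)
      hence xz: "x * z = - a3 * l" using False mult_left_cancel by blast
      have x: "x = l^2 + a1 * l - a2 - z" by (simp add: z_def)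
      have on: "on_curve W (Affine z (- (l + a1) * z - a3))"
      proof -
        have "(- (l + a1) * z - a3)^2 + a1 * z * (- (l + a1) * z - a3) + a3 * (- (l + a1) * z - a3)
          - (z^3 + a2 * z^2) = z * ((l^2 + a1 * l - a2 - z) * z - - a3 * l)"
          by (simp add: algebra_simps eval_nat_numeral)
        also have "\<dots> = 0" unfolding x[symmetric] by (simp add: xz)
        finally show ?thesis by (simp add: W)
      qed
      have "point_add W (Affine 0 0) (Affine z (l * z)) = point_neg W Q"
      proof (cases "z = 0")
        \<comment> \<open>The third point of the line is now the origin itself, so the doubling
          formula applies, with tangent y = 0.\<close>
        case True
        with xz a3 have "l = 0" by simp
        with True x y show ?thesis using a3 by (simp add: W Affine Let_def)
      next
        case False
        have "l * z / z = l" using False by simp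
        thus ?thesis
          unfolding W origin_add_Affine[OF False]
          by (simp only: x[symmetric]) (simp add: Affine y algebra_simps)
      qed
      thus ?thesis using on unfolding add neg by blast
    qed
  qed
  thus "on_curve W (point_add W (Affine 0 0) Q)"
    and "point_add W (Affine 0 0) (point_neg W (point_add W (Affine 0 0) Q)) = point_neg W Q"
    by blast+
qed

lemma on_curve_origin_mult:
  assumes "a3 \<noteq> 0" and "W = Weierstrass a1 a2 a3 0 0"
  shows "on_curve W (point_mult W n (Affine 0 0))"
  by (induction n) (simp_all add: on_curve_origin_add[OF assms])

text \<open>Descends from \<open>n\<close> times the origin being \<open>Infinity\<close>: each step
  takes one copy of the origin off the left-hand multiple by
  \<open>origin_add_cancel\<close>.\<close>

lemma point_neg_origin_mult:
  assumes a3: "a3 \<noteq> 0" and W: "W = Weierstrass a1 a2 a3 0 0"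
    and n: "point_mult W n (Affine 0 0) = Infinity" and k: "k \<le> n"
  shows "point_neg W (point_mult W (n - k) (Affine 0 0)) = point_mult W k (Affine 0 0)"
  using k
proof (induction k)
  case 0
  thus ?case by (simp add: n)
next
  case (Suc k)
  have "n - k = Suc (n - Suc k)" using Suc.prems by simp
  hence "point_mult W (n - k) (Affine 0 0)
      = point_add W (Affine 0 0) (point_mult W (n - Suc k) (Affine 0 0))"
    by simp
  hence "point_mult W k (Affine 0 0) =
      point_neg W (point_add W (Affine 0 0) (point_mult W (n - Suc k) (Affine 0 0)))"
    using Suc by simp
  thus ?case
    using origin_add_cancel[OF a3 W on_curve_origin_mult[OF a3 W], of "n - Suc k"]
    by simp
qed

text \<open>Tate's normal form: the marked point is the origin, its tangent is y = 0, and the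
  remaining scaling has been used to make a2 and a3 equal.\<close>

definition tate_form :: "'a::field \<Rightarrow> 'a \<Rightarrow> 'a weierstrass" where
  "tate_form b c = Weierstrass (1 - c) (- b) (- b) 0 0"

text \<open>Order 9 makes 5 P the negative of 4 P for P the origin, so the two have the same
  abscissa. In terms of d = b / c and f = c / (d - 1) this equation becomes d - 1 = f (f - 1), a
  rational curve with parameter f.\<close>

lemma tate_form_order_9:
  fixes b c :: "'a::field"
  assumes b: "b \<noteq> 0" and ord: "has_order (tate_form b c) (Affine 0 0) 9"
  obtains f where "f \<noteq> 0" "f \<noteq> 1" "c = f^2 * (f - 1)" "b = f^2 * (f - 1) * (f^2 - f + 1)"
proof -
  let ?W = "tate_form b c"
  let ?O = "Affine 0 0 :: 'a point"
  define m where "m n = point_mult ?W n ?O" for n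
  have Suc: "m (Suc n) = point_add ?W ?O (m n)" for n by (simp add: m_def)
  have nz: "m n \<noteq> Infinity" if "0 < n" "n < 9" for n
    using ord that by (simp add: has_order_def m_def)
  have m1: "m 1 = ?O" by (simp add: m_def)
  have m2: "m 2 = Affine b (b * c)"
    using Suc[of 1] m1 b by (simp add: tate_form_def Let_def eval_nat_numeral algebra_simps)
  have m3: "m 3 = Affine c (b - c)"
    using Suc[of 2] m2 b
    by (simp add: tate_form_def origin_add_Affine eval_nat_numeral algebra_simps)
  \<comment> \<open>For \<open>c = 0\<close> the triple of the origin is (0, b), the negative of the
    origin, so that \<open>m 4\<close> would be \<open>Infinity\<close>. In the same way
    \<open>d = 1\<close> would make \<open>m 5\<close> equal to \<open>Infinity\<close>.\<close>
  have c: "c \<noteq> 0"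
    using Suc[of 3] m3 nz[of 4] by (auto simp: tate_form_def)
  define d where "d = b / c"
  have bcd: "b = c * d" using c by (simp add: d_def)
  have "(b - c) / c = d - 1" using c by (simp add: d_def diff_divide_distrib)
  hence m4: "m 4 = Affine (d * (d - 1)) (d^2 * (c - d + 1))"
    using Suc[of 3] m3 c
    by (simp add: tate_form_def origin_add_Affine eval_nat_numeral) (simp add: bcd algebra_simps)
  have d0: "d \<noteq> 0" using b bcd by auto
  have d1: "d \<noteq> 1"
    using Suc[of 4] m4 nz[of 5] bcd by (auto simp: tate_form_def)
  define f where "f = c / (d - 1)"
  have cf: "c = f * (d - 1)" using d1 by (simp add: f_def)
  have slope: "d^2 * (c - d + 1) / (d * (d - 1)) = d * (f - 1)"
    using d0 d1 by (simp add: cf divide_simps eval_nat_numeral) (simp add: algebra_simps)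
  obtain y where m5: "m 5 = Affine ((d * (f - 1))^2 + (1 - c) * (d * (f - 1)) - (- b) - d * (d - 1)) y"
    using Suc[of 4] m4 d0 d1 slope
    by (simp add: tate_form_def origin_add_Affine[where x = "d * (d - 1)", unfolded slope] Let_def)
  have "(d * (f - 1))^2 + (1 - c) * (d * (f - 1)) - (- b) - d * (d - 1) = d * (f - 1) * f"
    unfolding bcd cf by (simp add: algebra_simps eval_nat_numeral)
  moreover have "point_neg ?W (m 4) = m 5"
    using point_neg_origin_mult[of "- b" ?W "1 - c" "- b" 9 5] b ord
    by (simp add: m_def has_order_def tate_form_def)
  ultimately have "d * (f - 1) * f = d * (d - 1)"
    using m4 m5 by (auto simp: tate_form_def mult_ac)
  hence df: "d - 1 = f * (f - 1)" using d0 by (simp add: mult.commute)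
  show ?thesis
  proof (rule that[of f])
    show "f \<noteq> 0" using c cf by auto
    show "f \<noteq> 1" using d1 df by auto
    show cc: "c = f^2 * (f - 1)" using cf df by (simp add: power2_eq_square)
    have "d = f^2 - f + 1" using df by (simp add: algebra_simps power2_eq_square)
    thus "b = f^2 * (f - 1) * (f^2 - f + 1)" using bcd cc by simp
  qed
qed

text \<open>Move P to the origin and shear by the slope of its tangent, which kills a4 and a6. Then
  a3 is nonzero since 2 P is not \<open>Infinity\<close>, and a2 is nonzero since otherwise the
  origin would be a flex and 3 P would be \<open>Infinity\<close>.\<close>

lemma order_9_curve_iso_tate_form:
  fixes E :: "'a::field weierstrass"
  assumes curve: "on_curve E P" and ord: "has_order E P 9"
  obtains f where "f \<noteq> 0" "f \<noteq> 1"
    "curve_iso E (tate_form (f^2 * (f - 1) * (f^2 - f + 1)) (f^2 * (f - 1)))"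
proof -
  obtain a1 a2 a3 a4 a6 where E: "E = Weierstrass a1 a2 a3 a4 a6" by (cases E)
  have "P \<noteq> Infinity" and P2: "point_mult E 2 P \<noteq> Infinity"
    using ord by (auto simp: has_order_def)
  then obtain x y where P: "P = Affine x y" by (cases P) auto
  define h where "h = 2 * y + a1 * x + a3"
  have h: "h \<noteq> 0"
    using P2 by (auto simp: E P h_def eval_nat_numeral algebra_simps split: if_splits)
  define l where "l = (3 * x^2 + 2 * a2 * x + a4 - a1 * y) / h"
  define A1 A2 where "A1 = a1 + 2 * l" and "A2 = a2 - l * a1 + 3 * x - l^2"
  let ?W = "Weierstrass A1 A2 h 0 0"
  have "l * h = 3 * x^2 + 2 * a2 * x + a4 - a1 * y" using h by (simp add: l_def)
  hence "a4 - l * a3 + 2 * x * a2 - (y + x * l) * a1 + 3 * x^2 - 2 * l * y = 0"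
    unfolding h_def by (simp add: algebra_simps)
  moreover have "a6 + x * a4 + x^2 * a2 + x^3 - y * a3 - y^2 - x * y * a1 = 0"
    using curve by (simp add: E P algebra_simps)
  ultimately have tr: "is_transform 1 x l y E ?W"
    by (simp add: E A1_def A2_def h_def algebra_simps)
  have ordW: "has_order ?W (Affine 0 0) 9"
    using transform_has_order[OF tr, of 0 0 9] h ord by (simp add: P)
  have A2: "A2 \<noteq> 0"
  proof
    assume "A2 = 0"
    hence "point_mult ?W 3 (Affine 0 0) = Infinity"
      using h by (simp add: Let_def eval_nat_numeral)
    thus False using ordW by (simp add: has_order_def)
  qed
  \<comment> \<open>A scaling by \<open>u\<close> divides a2 by u^2 and a3 by u^3, so the quotient
    a3 / a2 is the \<open>u\<close> that makes them equal.\<close>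
  define u b c where "u = h / A2" and "b = - (A2 / u^2)" and "c = 1 - A1 / u"
  have u: "u \<noteq> 0" using h A2 by (simp add: u_def)
  have b: "b \<noteq> 0" using u A2 by (simp add: b_def)
  have eqs: "u * (1 - c) = A1" "u^2 * (- b) = A2" "u^3 * (- b) = h"
    using u A2 by (simp_all add: b_def c_def eval_nat_numeral) (simp add: u_def)
  have "is_transform u 0 0 0 ?W (tate_form b c)"
    using u eqs by (simp add: tate_form_def)
  hence "has_order (tate_form b c) (Affine 0 0) 9"
    using transform_has_order[of u 0 0 0 ?W "1 - c" "- b" "- b" 0 0 0 0 9] b ordW
    by (simp add: tate_form_def)
  then obtain f where f: "f \<noteq> 0" "f \<noteq> 1" "c = f^2 * (f - 1)"
      "b = f^2 * (f - 1) * (f^2 - f + 1)"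
    using tate_form_order_9[OF b] by blast
  have "is_transform (1 * u) x l y E (tate_form b c)"
    unfolding tate_form_def using tr u by (intro is_transform_rescale) (simp_all only: eqs mult_zero_right not_False_eq_True)
  hence "curve_iso E (tate_form b c)" unfolding curve_iso_iff_transform by blast
  thus ?thesis using that f by simp
qed

text \<open>
  The equation \<open>tate_form\<close> at \<open>f = m / n\<close>, with denominators cleared by the scaling \<open>u = n ^ -3\<close>.
\<close>

definition kubert_a1 :: "int \<Rightarrow> int \<Rightarrow> int" where
  "kubert_a1 m n = n^3 - m^2 * (m - n)"

definition kubert_a2 :: "int \<Rightarrow> int \<Rightarrow> int" where
  "kubert_a2 m n = - (n * m^2 * (m - n) * (m^2 - m * n + n^2))"

definition kubert_model :: "int \<Rightarrow> int \<Rightarrow> rat weierstrass" where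
  "kubert_model m n = Weierstrass (of_int (kubert_a1 m n)) (of_int (kubert_a2 m n))
     (of_int (n^3 * kubert_a2 m n)) 0 0"

definition kubert_disc :: "int \<Rightarrow> int \<Rightarrow> int" where
  "kubert_disc m n = (m * n * (m - n))^9 * (m^2 - m * n + n^2)^3 *
     (m^3 - 6 * m^2 * n + 3 * m * n^2 + n^3)"

text \<open>Arranged as \<open>(kubert_a1 m n)^4\<close> plus a multiple of
  \<open>kubert_a2 m n\<close>, so that a prime dividing the latter divides c4 only if it divides
  \<open>kubert_a1 m n\<close>.\<close>

definition kubert_c4 :: "int \<Rightarrow> int \<Rightarrow> int" where
  "kubert_c4 m n = (kubert_a1 m n)^4 + kubert_a2 m n *
     (8 * (kubert_a1 m n)^2 + 16 * kubert_a2 m n - 24 * kubert_a1 m n * n^3)"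

lemma integral_at_kubert_model: "prime p \<Longrightarrow> integral_at p (kubert_model m n)"
  using p_integral_of_int[of p 0] by (simp add: integral_at_def kubert_model_def del: of_int_mult)

lemma c4_kubert_model: "c4_invariant (kubert_model m n) = of_int (kubert_c4 m n)"
  by (simp add: kubert_model_def kubert_c4_def algebra_simps eval_nat_numeral)

text \<open>As a4 = a6 = 0 and a3 = n^3 a2, the factor n^6 a2^3 splits off before \<open>m\<close>
  and \<open>n\<close> are substituted. The cofactor then collapses to a product containing the
  cubic form.\<close>

lemma disc_kubert_model: "disc (kubert_model m n) = of_int (kubert_disc m n)"
proof -
  define A T where "A = kubert_a1 m n" and "T = kubert_a2 m n"
  have "disc (kubert_model m n) = of_int (n^6 * T^3 *
      (- (A^4) - 8 * A^2 * T - 16 * T^2 + A^3 * n^3 - 27 * n^6 * T + 36 * A * n^3 * T))"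
    by (simp add: kubert_model_def A_def T_def Let_def algebra_simps eval_nat_numeral)
  moreover have "- (A^4) - 8 * A^2 * T - 16 * T^2 + A^3 * n^3 - 27 * n^6 * T + 36 * A * n^3 * T =
      - (m^3 * (m - n)^6 * (m^3 - 6 * m^2 * n + 3 * m * n^2 + n^3))"
    unfolding A_def T_def kubert_a1_def kubert_a2_def by (simp add: algebra_simps eval_nat_numeral)
  moreover have "n^6 * T^3 * - (m^3 * (m - n)^6 * g) =
      (m * n * (m - n))^9 * (m^2 - m * n + n^2)^3 * g" for g
    unfolding T_def kubert_a2_def power_mult_distrib
    by (simp add: power_mult_distrib mult_ac flip: power_add power_mult)
  ultimately show ?thesis by (simp only: kubert_disc_def)
qed

lemma curve_iso_kubert_model:
  assumes iso: "curve_iso E (tate_form (f^2 * (f - 1) * (f^2 - f + 1)) (f^2 * (f - 1)))"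
    and f: "f = of_int m / of_int n" and n: "n \<noteq> 0"
  shows "curve_iso E (kubert_model m n)"
proof -
  obtain u r s t where tr:
    "is_transform u r s t E (tate_form (f^2 * (f - 1) * (f^2 - f + 1)) (f^2 * (f - 1)))"
    using iso curve_iso_iff_transform by blast
  define N where "N = (of_int n :: rat)"
  have N: "N \<noteq> 0" and m: "of_int m = f * N" using f n by (simp_all add: N_def)
  have a1: "of_int (kubert_a1 m n) = N^3 * (1 - f^2 * (f - 1))"
    by (simp add: kubert_a1_def m flip: N_def) (simp add: algebra_simps eval_nat_numeral)
  have a2: "of_int (kubert_a2 m n) = N^6 * - (f^2 * (f - 1) * (f^2 - f + 1))"
    by (simp add: kubert_a2_def m flip: N_def) (simp add: algebra_simps eval_nat_numeral)
  have a3: "of_int (n^3 * kubert_a2 m n) = N^9 * - (f^2 * (f - 1) * (f^2 - f + 1))"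
    by (simp add: a2 flip: N_def power_add)
  let ?v = "1 / N^3"
  have cancel: "?v * (N^3 * z) = z" "?v^2 * (N^6 * z) = z" "?v^3 * (N^9 * z) = z" for z
    using N by (simp_all add: power_divide flip: power_mult)
  have "is_transform (u * ?v) r s t E (kubert_model m n)"
    unfolding kubert_model_def using tr N
    by (intro is_transform_rescale) (simp_all only: a1 a2 a3 cancel tate_form_def mult_zero_right, simp)
  thus ?thesis using curve_iso_iff_transform by blast
qed

section \<open>Reduction and minimal discriminant\<close>

text \<open>The number \<open>v\<close> is the quotient of the scalings that lead from
  \<open>E\<close> to the two models. Later comparisons of models come down to its
  valuation.\<close>

lemma curve_iso_invariants:
  fixes E :: "'a::field weierstrass"
  assumes "curve_iso E V" "curve_iso E W"
  obtains v where "v \<noteq> 0" "disc W = v ^ 12 * disc V" "c4_invariant W = v ^ 4 * c4_invariant V"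
proof -
  obtain u r s t where V: "is_transform u r s t E V" using assms curve_iso_iff_transform by blast
  obtain u' r' s' t' where W: "is_transform u' r' s' t' E W"
    using assms curve_iso_iff_transform by blast
  have u: "u \<noteq> 0" "u' \<noteq> 0"
    using V W by (cases E; cases V; cases W; simp)+
  have "u' ^ 12 * disc W = u ^ 12 * disc V" "u' ^ 4 * c4_invariant W = u ^ 4 * c4_invariant V"
    using transform_invariants[OF V] transform_invariants[OF W] by simp_all
  hence "disc W = (u / u') ^ 12 * disc V" "c4_invariant W = (u / u') ^ 4 * c4_invariant V"
    using u by (simp_all add: power_divide field_simps)
  thus ?thesis using that[of "u / u'"] u by simp
qed

text \<open>In a model \<open>W\<close> of good reduction, c4 is \<open>p\<close>-integral; as it is
  a unit at \<open>p\<close> in \<open>V\<close>, the scaling has nonnegative valuation. Hence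
  \<open>p\<close> still divides the discriminant of \<open>W\<close>.\<close>

lemma bad_reduction_if_not_dvd_c4:
  assumes p: "prime p" and iso: "curve_iso E V"
    and D: "disc V = of_int D" "D \<noteq> 0" "int p dvd D"
    and C: "c4_invariant V = of_int C" "\<not> int p dvd C"
  shows "\<not> good_reduction p E"
proof
  assume "good_reduction p E"
  then obtain W where W: "curve_iso E W" "integral_at p W" "\<not> p_divides p (disc W)"
    by (auto simp: good_reduction_def minimal_model_at_def)
  obtain v where v: "v \<noteq> 0" "disc W = v ^ 12 * disc V" "c4_invariant W = v ^ 4 * c4_invariant V"
    using curve_iso_invariants[OF iso W(1)] .
  have "C \<noteq> 0" using C by auto
  have "p_integral p (c4_invariant W)" by (rule p_integral_c4[OF p W(2)])
  hence "p_val p (v ^ 4 * of_int C) \<ge> 0"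
    using v C \<open>C \<noteq> 0\<close> p_integral_iff_p_val[OF p] by simp
  hence "p_val p v \<ge> 0"
    using v(1) C \<open>C \<noteq> 0\<close> p
    by (simp add: p_val_mult p_val_power p_val_of_int not_dvd_imp_multiplicity_0)
  moreover have "multiplicity (int p) D > 0"
    using p D by (simp add: prime_multiplicity_gt_zero_iff)
  ultimately have "p_val p (v ^ 12 * of_int D) > 0"
    using v(1) D p by (simp add: p_val_mult p_val_power p_val_of_int)
  thus False
    using W(3) v D p_divides_iff_p_val[OF p] by simp
qed

text \<open>Discriminants of isomorphic models have the same valuation modulo 12, and good reduction
  would make it 0. This criterion serves the case where \<open>p\<close> also divides c4.\<close>

lemma bad_reduction_if_multiplicity:
  assumes p: "prime p" and iso: "curve_iso E V"
    and D: "disc V = of_int D" "D \<noteq> 0" "\<not> 12 dvd multiplicity (int p) D"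
  shows "\<not> good_reduction p E"
proof
  assume "good_reduction p E"
  then obtain W where W: "curve_iso E W" "integral_at p W" "\<not> p_divides p (disc W)"
    by (auto simp: good_reduction_def minimal_model_at_def)
  obtain v where v: "v \<noteq> 0" "disc W = v ^ 12 * disc V"
    using curve_iso_invariants[OF iso W(1)] by metis
  have nz: "disc W \<noteq> 0" using v D by simp
  have "p_val p (disc W) = 0"
    using p_integral_disc[OF p W(2)] W(3) p_integral_iff_p_val[OF p nz] p_divides_iff_p_val[OF p nz]
    by simp
  hence "12 * p_val p v + int (multiplicity (int p) D) = 0"
    using v D p by (simp add: p_val_mult p_val_power p_val_of_int)
  hence "12 dvd int (multiplicity (int p) D)" by presburger
  with D(3) show False by presburger
qed

section \<open>Minimality from a discriminant of valuation below 12\<close>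

text \<open>A scaling of negative valuation would lower the valuation of the discriminant by at
  least 12 and so make it negative.\<close>

lemma p_val_disc_bound:
  assumes p: "prime p" and v: "v \<noteq> 0" "disc W = v ^ 12 * of_int D"
    and D: "D \<noteq> 0" "multiplicity (int p) D < 12" and W: "integral_at p W"
  shows "p_val p v \<ge> 0" and "p_val p (disc W) = 12 * p_val p v + int (multiplicity (int p) D)"
proof -
  show eq: "p_val p (disc W) = 12 * p_val p v + int (multiplicity (int p) D)"
    using v D p by (simp add: p_val_mult p_val_power p_val_of_int)
  have "p_val p (disc W) \<ge> 0"
    using p_integral_disc[OF p W] p_integral_iff_p_val[OF p] v D by simp
  with eq D(2) show "p_val p v \<ge> 0" by linarith
qed

lemma minimal_model_at_if_multiplicity:
  assumes p: "prime p" and iso: "curve_iso E V" and int: "integral_at p V"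
    and D: "disc V = of_int D" "D \<noteq> 0" "multiplicity (int p) D < 12"
  shows "minimal_model_at p E V"
  unfolding minimal_model_at_def
proof (intro conjI allI impI iso int)
  fix W assume W: "curve_iso E W \<and> integral_at p W"
  then obtain v where v: "v \<noteq> 0" "disc W = v ^ 12 * disc V"
    using curve_iso_invariants[OF iso] by metis
  show "p_val p (disc V) \<le> p_val p (disc W)"
    using p_val_disc_bound[OF p v(1) _ D(2,3)] v W D p by (simp add: p_val_of_int)
qed

text \<open>For uniqueness, two global minimal discriminants have equal valuation at every prime,
  hence equal absolute value; their quotient is a twelfth power, so their signs agree as
  well.\<close>

lemma min_disc_eqI:
  assumes iso: "curve_iso E V" and int: "\<And>p. prime p \<Longrightarrow> integral_at p V"
    and D: "disc V = of_int D" "D \<noteq> 0" "\<And>p. prime p \<Longrightarrow> multiplicity (int p) D < 12"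
  shows "min_disc E = D"
  unfolding min_disc_def
proof (rule the_equality)
  have "global_minimal_model E V"
    unfolding global_minimal_model_def
    using minimal_model_at_if_multiplicity[OF _ iso int D] by blast
  thus "\<exists>W. global_minimal_model E W \<and> disc W = of_int D" using D by blast
next
  fix D' assume "\<exists>W. global_minimal_model E W \<and> disc W = of_int D'"
  then obtain W where W: "global_minimal_model E W" "disc W = of_int D'" by blast
  \<comment> \<open>\<open>global_minimal_model\<close> contains the isomorphism only under a
    quantifier over primes; the prime 2 is an arbitrary instance.\<close>
  have "curve_iso E W"
    using W(1) two_is_prime_nat by (auto simp: global_minimal_model_def minimal_model_at_def)
  then obtain v where v: "v \<noteq> 0" "disc W = v ^ 12 * disc V"
    using curve_iso_invariants[OF iso] by metis
  have eq: "of_int D' = v ^ 12 * of_int D" using v W(2) D by simp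
  hence D': "D' \<noteq> 0" using v(1) D(2) by auto
  have "multiplicity q D = multiplicity q D'" if "prime q" for q :: int
  proof -
    define p where "p = nat q"
    have p: "prime p" and q: "q = int p"
      using that by (simp_all add: p_def prime_ge_0_int)
    have V: "minimal_model_at p E V"
      by (rule minimal_model_at_if_multiplicity[OF p iso int[OF p] D(1,2) D(3)[OF p]])
    have "minimal_model_at p E W" using W(1) p by (simp add: global_minimal_model_def)
    with V have "p_val p (disc V) = p_val p (disc W)"
      by (auto simp: minimal_model_at_def intro!: antisym)
    thus ?thesis using p D W(2) D' q by (simp add: p_val_of_int)
  qed
  hence "normalize D = normalize D'"
    using D(2) D' by (intro multiplicity_eq_imp_eq) auto
  hence "\<bar>D\<bar> = \<bar>D'\<bar>" by simp
  moreover have "v ^ 12 > 0" using v(1) by (simp add: zero_less_power_eq)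
  hence "sgn (of_int D' :: rat) = sgn (of_int D)"
    unfolding eq sgn_mult using sgn_pos[of "v ^ 12"] by (simp only: mult_1_left)
  hence "sgn D' = sgn D" by (simp add: sgn_if split: if_splits)
  ultimately show "D' = D" by (metis abs_mult_sgn)
qed

text \<open>Modulo 3, both \<open>c4\<close> and the square of the discriminant of the tangent cone equal \<open>b2 ^ 2\<close>.\<close>

lemma not_dvd_c4_if_node_3:
  assumes int: "integral_at 3 W" and node: "reduction_has_node 3 W"
  shows "\<not> p_divides 3 (c4_invariant W)"
proof
  assume dvd: "p_divides 3 (c4_invariant W)"
  have p: "prime (3::nat)" by simp
  obtain a1 a2 a3 a4 a6 where W: "W = Weierstrass a1 a2 a3 a4 a6" by (cases W)
  obtain x0 :: int where x: "\<not> p_divides 3 (a1^2 + 4 * (3 * of_int x0 + a2))"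
    using node by (auto simp: W Let_def)
  have a: "p_integral 3 a1" "p_integral 3 a2" "p_integral 3 a3" "p_integral 3 a4"
    using int by (simp_all add: W integral_at_def)
  define b2 where "b2 = a1^2 + 4 * a2"
  obtain z where z: "p_integral 3 z" "c4_invariant W = 3 * z"
    using dvd p_divides_iff_multiple[OF p] by auto
  have "b2^2 = 3 * (z + 8 * (2 * a4 + a1 * a3))"
    using z(2) by (simp add: W b2_def algebra_simps)
  moreover have "p_integral 3 (z + 8 * (2 * a4 + a1 * a3))"
    using a z(1) by (intro p_integral_intros p)
  ultimately have sq: "p_divides 3 (b2^2)"
    using p_divides_iff_multiple[OF p] by auto
  have "p_divides 3 b2"
  proof (cases "b2 = 0")
    case True
    with sq show ?thesis by simp
  next
    case False
    with sq show ?thesis using p by (simp add: p_divides_iff_p_val p_val_power)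
  qed
  then obtain w where w: "p_integral 3 w" "b2 = 3 * w"
    using p_divides_iff_multiple[OF p] by auto
  have "a1^2 + 4 * (3 * of_int x0 + a2) = 3 * (w + 4 * of_int x0)"
    using w(2) by (simp add: b2_def algebra_simps)
  moreover have "p_integral 3 (w + 4 * of_int x0)"
    using w(1) by (intro p_integral_intros p p_integral_of_int)
  ultimately have "p_divides 3 (a1^2 + 4 * (3 * of_int x0 + a2))"
    using p_divides_iff_multiple[OF p] by auto
  with x show False by blast
qed

text \<open>By \<open>p_val_disc_bound\<close>, passing from \<open>V\<close> to a model integral at
  3 multiplies c4 by the fourth power of a 3-integral number. So 3 divides c4 of every minimal model
  at 3, which excludes a node.\<close>

lemma not_multiplicative_reduction_3:
  assumes iso: "curve_iso E V" and int: "integral_at 3 V"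
    and D: "disc V = of_int D" "D \<noteq> 0" "multiplicity 3 D < 12"
    and C: "c4_invariant V = of_int C" "3 dvd C"
  shows "\<not> multiplicative_reduction 3 E"
proof
  have p: "prime (3::nat)" by simp
  assume "multiplicative_reduction 3 E"
  then obtain W where W: "minimal_model_at 3 E W" "reduction_has_node 3 W"
    by (auto simp: multiplicative_reduction_def)
  hence W': "curve_iso E W" "integral_at 3 W"
    by (auto simp: minimal_model_at_def)
  obtain v where v: "v \<noteq> 0" "disc W = v ^ 12 * disc V" "c4_invariant W = v ^ 4 * c4_invariant V"
    using curve_iso_invariants[OF iso W'(1)] .
  have val: "p_val 3 v \<ge> 0"
    using p_val_disc_bound(1)[OF p v(1), of W D] v(2) D W'(2) by simp
  have "p_divides 3 (v ^ 4 * of_int C)"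
  proof (cases "C = 0")
    case True
    thus ?thesis by (simp add: p_divides_def)
  next
    case False
    have "multiplicity 3 C > 0"
      using C(2) False by (simp add: prime_multiplicity_gt_zero_iff)
    thus ?thesis
      using val v(1) False p
      by (simp add: p_divides_iff_p_val p_val_mult p_val_power p_val_of_int)
  qed
  hence "p_divides 3 (c4_invariant W)" by (simp add: v(3) C(1))
  with not_dvd_c4_if_node_3[OF W'(2) W(2)] show False by blast
qed

section \<open>Conductors with two prime divisors\<close>

lemma conductor_exponent_pos: "\<not> good_reduction p E \<Longrightarrow> conductor_exponent p E > 0"
  by (simp add: conductor_exponent_def)

text \<open>
  A conductor different from 1 has finitely many factors, as an infinite product is 1 by
  convention.
\<close>

lemma finite_bad_primes:
  "conductor E \<noteq> 1 \<Longrightarrow> finite {p. prime p \<and> \<not> good_reduction p E}"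
  unfolding conductor_def by (rule ccontr) simp

lemma bad_prime_power_dvd_conductor:
  assumes "conductor E \<noteq> 1" "prime p" "\<not> good_reduction p E"
  shows "p ^ conductor_exponent p E dvd conductor E"
  unfolding conductor_def using finite_bad_primes[OF assms(1)] assms(2,3) by (intro dvd_prodI) auto

lemma bad_prime_dvd_conductor:
  assumes "conductor E \<noteq> 1" "prime p" "\<not> good_reduction p E"
  shows "p dvd conductor E"
  using bad_prime_power_dvd_conductor[OF assms] conductor_exponent_pos[OF assms(3)]
  by (meson dvd_power dvd_trans)

lemma conductor_pos: "conductor E > 0"
  unfolding conductor_def by (rule prod_pos) (auto dest: prime_gt_0_nat)

section \<open>Prime divisors of the factors of Kubert's discriminant\<close>

text \<open>The quadratic form is congruent to n^2 modulo \<open>m\<close> and modulo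
  \<open>m - n\<close>, and to m^2 modulo \<open>n\<close> and modulo \<open>m - n\<close>; a common
  prime would divide both \<open>m\<close> and \<open>n\<close>.\<close>

lemma kubert_form_prime_factor:
  assumes p: "prime (p::int)" and "coprime m n" and "p dvd m^2 - m * n + n^2"
  shows "\<not> p dvd m * n * (m - n)"
proof
  assume "p dvd m * n * (m - n)"
  hence cases: "p dvd m \<or> p dvd n \<or> p dvd m - n" using p by (simp add: prime_dvd_mult_iff)
  have "n^2 = (m^2 - m * n + n^2) - m * (m - n)" "m^2 = (m^2 - m * n + n^2) + n * (m - n)"
    by (simp_all add: algebra_simps power2_eq_square)
  hence "p dvd m \<or> p dvd m - n \<Longrightarrow> p dvd n^2" "p dvd n \<or> p dvd m - n \<Longrightarrow> p dvd m^2"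
    using assms(3) by (metis dvd_add dvd_diff dvd_mult dvd_mult2)+
  hence "p dvd m" "p dvd n" using cases p prime_dvd_power by blast+
  thus False using assms(2) p by (meson coprime_common_divisor not_prime_unit)
qed

text \<open>\<open>kubert_a1 m n\<close> is congruent to n^3 modulo \<open>m\<close> and
  \<open>m - n\<close>, to - m^3 modulo \<open>n\<close>, and to n^2 (m + n) modulo the quadratic
  form. In the last case \<open>p\<close> divides m + n, and (m + n)^2 minus the form is 3 m n, so
  only \<open>p = 3\<close> survives.\<close>

lemma not_dvd_kubert_a1:
  assumes p: "prime (p::int)" and cop: "coprime m n"
    and dvd: "p dvd m * n * (m - n) * (m^2 - m * n + n^2)"
    and 3: "p = 3 \<Longrightarrow> \<not> p dvd m^2 - m * n + n^2"
  shows "\<not> p dvd kubert_a1 m n"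
proof
  assume a1: "p dvd kubert_a1 m n"
  have not_both: "\<not> (p dvd m \<and> p dvd n)"
    using cop p by (meson coprime_common_divisor not_prime_unit)
  consider "p dvd m \<or> p dvd m - n" | "p dvd n" | "p dvd m^2 - m * n + n^2"
    using dvd p by (auto simp: prime_dvd_mult_iff)
  thus False
  proof cases
    case 1
    have "n^3 = kubert_a1 m n + m^2 * (m - n)" by (simp add: kubert_a1_def)
    moreover have "p dvd m^2 * (m - n)" using 1 by (auto simp: power2_eq_square)
    ultimately have "p dvd n^3" using a1 by (metis dvd_add)
    hence "p dvd n" using p prime_dvd_power by blast
    with 1 have "p dvd m" using dvd_diffD1 by (metis diff_add_cancel dvd_add)
    with \<open>p dvd n\<close> not_both show False by blast
  next
    case 2
    have "m^3 = n * (n^2 + m^2) - kubert_a1 m n"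
      by (simp add: kubert_a1_def algebra_simps eval_nat_numeral)
    hence "p dvd m^3" using 2 a1 by (metis dvd_diff dvd_mult2)
    hence "p dvd m" using p prime_dvd_power by blast
    with 2 not_both show False by blast
  next
    case k: 3
    have mn: "\<not> p dvd m" "\<not> p dvd n"
      using kubert_form_prime_factor[OF p cop k] p by (auto simp: prime_dvd_mult_iff)
    have "n^2 * (m + n) = kubert_a1 m n + m * (m^2 - m * n + n^2)"
      by (simp add: kubert_a1_def algebra_simps eval_nat_numeral)
    hence "p dvd n^2 * (m + n)" using a1 k by (metis dvd_add dvd_mult)
    hence "p dvd m + n" using mn p by (auto simp: prime_dvd_mult_iff prime_dvd_power_iff)
    moreover have "3 * (m * n) = (m + n) * (m + n) - (m^2 - m * n + n^2)"
      by (simp add: algebra_simps power2_eq_square)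
    ultimately have "p dvd 3 * (m * n)" using k by (metis dvd_diff dvd_mult)
    hence "p dvd 3" using mn p by (auto simp: prime_dvd_mult_iff)
    hence "p = 3" using p primes_dvd_imp_eq[of p 3] by simp
    with 3 k show False by blast
  qed
qed

text \<open>Here n is congruent to - m modulo 3. Then the quadratic form has valuation 1, the cubic
  form valuation 2, and \<open>m * n * (m - n)\<close> is prime to 3, which gives 3 * 1 + 2 =
  5.\<close>

lemma multiplicity_3_kubert_disc:
  assumes cop: "coprime m n" and dvd: "3 dvd m^2 - m * n + n^2"
  shows "multiplicity 3 (kubert_disc m n) = 5"
proof -
  have p: "prime (3::int)" by simp
  have not_dvd: "\<not> 3 dvd m * n * (m - n)" by (rule kubert_form_prime_factor[OF p cop dvd])
  hence m: "\<not> 3 dvd m" by auto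
  have "(m + n)^2 = (m^2 - m * n + n^2) + 3 * (m * n)"
    by (simp add: algebra_simps power2_eq_square)
  hence "3 dvd (m + n)^2" using dvd by (metis dvd_add dvd_triv_left)
  hence "3 dvd m + n" using p prime_dvd_power by blast
  then obtain j where "m + n = 3 * j" by blast
  hence n: "n = 3 * j - m" by simp
  define k g where "k = m^2 + 3 * (j^2 - j * m)" and "g = m^3 + 3 * (j^3 - m^2 * j)"
  have k: "\<not> 3 dvd k" and g: "\<not> 3 dvd g"
    using m p by (auto simp: k_def g_def dvd_add_left_iff prime_dvd_power_iff)
  have g': "m^3 - 6 * m^2 * n + 3 * m * n^2 + n^3 = 9 * g"
    and k': "m^2 - m * n + n^2 = 3 * k"
    unfolding n k_def g_def by (simp_all add: algebra_simps eval_nat_numeral)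
  define w where "w = (m * n * (m - n))^9 * k^3 * g"
  have "kubert_disc m n = 3^5 * w"
    unfolding kubert_disc_def g' k' w_def by (simp add: power_mult_distrib)
  moreover have "\<not> 3 dvd w"
    using k g not_dvd p unfolding w_def by (simp add: prime_dvd_mult_iff prime_dvd_power_iff)
  ultimately show ?thesis
    by (intro multiplicity_eqI) (auto simp: power_Suc)
qed

text \<open>The c4 criterion covers everything except 3 dividing the quadratic form; there the
  discriminant has valuation 5, not a multiple of 12.\<close>

lemma kubert_bad_reduction:
  assumes p: "prime p" and cop: "coprime m n" and iso: "curve_iso E (kubert_model m n)"
    and D: "kubert_disc m n \<noteq> 0"
    and dvd: "int p dvd m * n * (m - n) * (m^2 - m * n + n^2)"
  shows "\<not> good_reduction p E"
proof (cases "p = 3 \<and> 3 dvd m^2 - m * n + n^2")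
  case True
  thus ?thesis
    using bad_reduction_if_multiplicity[OF p iso disc_kubert_model D]
      multiplicity_3_kubert_disc[OF cop] by simp
next
  case False
  have q: "prime (int p)" using p by simp
  have "int p dvd kubert_disc m n"
    using dvd q unfolding kubert_disc_def
    by (auto simp: prime_dvd_mult_iff prime_dvd_power_iff)
  moreover have "\<not> int p dvd kubert_c4 m n"
  proof
    assume "int p dvd kubert_c4 m n"
    moreover have "int p dvd kubert_a2 m n"
      using dvd q unfolding kubert_a2_def by (auto simp: prime_dvd_mult_iff prime_dvd_power_iff)
    ultimately have "int p dvd (kubert_a1 m n)^4"
      unfolding kubert_c4_def by (simp add: dvd_add_left_iff)
    hence "int p dvd kubert_a1 m n" using q prime_dvd_power by blast
    moreover have "\<not> int p dvd kubert_a1 m n"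
      using not_dvd_kubert_a1[OF q cop dvd] False by auto
    ultimately show False by blast
  qed
  ultimately show ?thesis
    using bad_reduction_if_not_dvd_c4[OF p iso disc_kubert_model D _ c4_kubert_model] by blast
qed

text \<open>For \<open>m * n < 0\<close> the form exceeds m^2 + n^2; otherwise it is (m - n)^2 + m n
  with both summands positive.\<close>

lemma kubert_form_gt_1:
  fixes m n :: int
  assumes "m \<noteq> 0" "n \<noteq> 0" "m \<noteq> n"
  shows "m^2 - m * n + n^2 > 1"
proof -
  have "m * n \<noteq> 0" "(m - n)^2 > 0" using assms by auto
  hence "m * n \<ge> 1 \<or> - (m * n) \<ge> 1" "(m - n)^2 \<ge> 1" by linarith+
  moreover have "m^2 - m * n + n^2 = (m - n)^2 + m * n"
    by (simp add: algebra_simps power2_eq_square)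
  moreover have "m^2 \<ge> 1" "n^2 \<ge> 1" using assms by (simp_all add: int_one_le_iff_zero_less)
  ultimately show ?thesis by linarith
qed

lemma odd_unit_if_prime_factors_2:
  fixes a :: int
  assumes "odd a" and "\<And>p. prime p \<Longrightarrow> p dvd a \<Longrightarrow> p = 2"
  shows "\<bar>a\<bar> = 1"
proof (rule ccontr)
  assume "\<bar>a\<bar> \<noteq> 1"
  hence "\<not> is_unit a" by simp
  then obtain p where "prime p" "p dvd a"
    using prime_divisor_exists[of a] assms(1) by auto
  with assms show False by auto
qed

text \<open>By coprimality exactly one of \<open>m\<close>, \<open>n\<close>, \<open>m - n\<close>
  is even, and the two odd ones are units. Each choice of the even one leaves one pair.\<close>

lemma coprime_differences_powers_of_2:
  fixes m n :: int
  assumes cop: "coprime m n" and nz: "m \<noteq> 0" "n > 0" "m \<noteq> n"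
    and 2: "\<And>p. prime p \<Longrightarrow> p dvd m * n * (m - n) \<Longrightarrow> p = 2"
  shows "(m, n) \<in> {(2, 1), (1, 2), (-1, 1)}"
proof -
  have unit: "\<bar>a\<bar> = 1" if "odd a" "a dvd m * n * (m - n)" for a
    using odd_unit_if_prime_factors_2[OF that(1)] 2 that(2) dvd_trans by blast
  have units: "odd m \<Longrightarrow> \<bar>m\<bar> = 1" "odd n \<Longrightarrow> n = 1" "odd (m - n) \<Longrightarrow> \<bar>m - n\<bar> = 1"
    using unit[of m] unit[of n] unit[of "m - n"] nz by auto
  have "\<not> (even m \<and> even n)" using cop by (auto dest: coprime_common_divisor)
  then consider "even m" "odd n" | "odd m" "even n" | "odd m" "odd n" by blast
  thus ?thesis
  proof cases
    case 1
    with units have "n = 1" "\<bar>m - n\<bar> = 1" by auto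
    with nz show ?thesis by auto
  next
    case 2
    with units have "\<bar>m\<bar> = 1" "\<bar>m - n\<bar> = 1" by auto
    with nz show ?thesis by auto
  next
    case 3
    with units have "\<bar>m\<bar> = 1" "n = 1" by auto
    with nz show ?thesis by auto
  qed
qed

lemma order_9_kubert_model:
  assumes "on_curve E P" "has_order E P 9"
  obtains m n where "coprime m n" "m \<noteq> 0" "n > 0" "m \<noteq> n" "curve_iso E (kubert_model m n)"
proof -
  obtain f where f: "f \<noteq> 0" "f \<noteq> 1"
    "curve_iso E (tate_form (f^2 * (f - 1) * (f^2 - f + 1)) (f^2 * (f - 1)))"
    using order_9_curve_iso_tate_form[OF assms] .
  obtain m n where mn: "n > 0" "coprime m n" "f = of_int m / of_int n"
    by (rule quotient_of_props)
  show ?thesis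
    using that[OF mn(2) _ mn(1) _ curve_iso_kubert_model[OF f(3) mn(3)]] f mn by auto
qed

text \<open>A prime \<open>r\<close> dividing the quadratic form is bad and does not divide
  \<open>m * n * (m - n)\<close>, while 2 divides that product and is bad too. So \<open>p\<close>
  and \<open>q\<close> are already 2 and \<open>r\<close>, and no other prime can divide the
  product.\<close>

lemma kubert_model_two_bad_primes:
  assumes D: "kubert_disc m n \<noteq> 0" and cop: "coprime m n" and iso: "curve_iso E (kubert_model m n)"
    and nz: "m \<noteq> 0" "n > 0" "m \<noteq> n"
    and p: "prime p" and q: "prime q" and N: "conductor E = p ^ \<alpha> * q ^ \<beta>" "conductor E \<noteq> 1"
  shows "(m, n) \<in> {(2, 1), (1, 2), (-1, 1)}"
proof -
  define k where "k = m^2 - m * n + n^2"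
  have bad: "r \<in> {p, q}" if "prime r" "int r dvd m * n * (m - n) \<or> int r dvd k" for r
  proof -
    have "\<not> good_reduction r E"
      using kubert_bad_reduction[OF that(1) cop iso D] that(2) by (auto simp: k_def)
    hence "r dvd p ^ \<alpha> * q ^ \<beta>"
      using bad_prime_dvd_conductor[OF N(2) that(1)] N(1) by simp
    hence "r dvd p \<or> r dvd q"
      using that(1) prime_dvd_mult_iff prime_dvd_power by blast
    thus ?thesis using that(1) p q primes_dvd_imp_eq by blast
  qed
  have "k > 1" unfolding k_def using nz by (intro kubert_form_gt_1) auto
  hence "\<not> is_unit k" by simp
  then obtain r' where r': "prime r'" "r' dvd k"
    using prime_divisor_exists[of k] \<open>k > 1\<close> by auto
  define r where "r = nat r'"
  have r: "prime r" "int r dvd k" "int r = r'" using r' by (simp_all add: r_def prime_ge_0_int)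
  have not_r: "\<not> int r dvd m * n * (m - n)"
    using kubert_form_prime_factor[OF _ cop] r' r(3) k_def by blast
  have even: "even (m * n * (m - n))" by auto
  have "s = 2" if s: "prime s" "s dvd m * n * (m - n)" for s :: int
  proof -
    have s': "prime (nat s)" "int (nat s) = s" using s(1) by (simp_all add: prime_ge_0_int)
    have "nat s \<noteq> r" "2 \<noteq> r" using not_r s even s' by auto
    moreover have "{2, r, nat s} \<subseteq> {p, q}"
      using bad[of 2] bad[OF r(1)] bad[OF s'(1)] r(2) s(2) s'(2) even by auto
    ultimately have "nat s = 2" by auto
    thus ?thesis using s'(2) by simp
  qed
  thus ?thesis by (rule coprime_differences_powers_of_2[OF cop nz])
qed

text \<open>For \<open>p \<ge> 3\<close> the power p^12 is too large to be a divisor; for 2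
  divisibility is refuted by computation.\<close>

lemma multiplicity_disc_less_12:
  assumes p: "prime p"
  shows "multiplicity (int p) (- (2 ^ 9 * 3 ^ 5)) < 12"
proof (rule ccontr)
  assume "\<not> ?thesis"
  hence "int p ^ 12 dvd - (2 ^ 9 * 3 ^ 5)"
    by (intro multiplicity_dvd') simp
  hence "int (p ^ 12) dvd int (2 ^ 9 * 3 ^ 5)"
    by (simp only: of_nat_mult of_nat_power of_nat_numeral dvd_minus_iff)
  hence dvd: "p ^ 12 dvd 2 ^ 9 * 3 ^ 5"
    by (simp only: int_dvd_int_iff)
  show False
  proof (cases "p \<ge> 3")
    case True
    have "(3::nat) ^ 12 \<le> p ^ 12" using True by (rule power_mono) simp
    also have "\<dots> \<le> 2 ^ 9 * 3 ^ 5" using dvd by (rule dvd_imp_le) simp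
    finally show False by simp
  next
    case False
    hence "p = 2" using prime_ge_2_nat[OF p] by simp
    with dvd show False by (simp add: dvd_eq_mod_eq_0)
  qed
qed

lemma order9_two_prime_curve_min_disc_conductor:
  assumes "order9_two_prime_curve E"
  shows "min_disc E = - (2 ^ 9 * 3 ^ 5)" and "conductor E \<ge> 18"
proof -
  obtain P p q \<alpha> \<beta> where E: "elliptic_curve E" "on_curve E P" "has_order E P 9"
    and pq: "prime p" "prime q" "0 < \<alpha>" "conductor E = p ^ \<alpha> * q ^ \<beta>"
    using assms unfolding order9_two_prime_curve_def by blast
  obtain m n where mn: "coprime m n" "m \<noteq> 0" "n > 0" "m \<noteq> n"
    and iso: "curve_iso E (kubert_model m n)"
    using order_9_kubert_model[OF E(2,3)] .
  obtain u r s t where "is_transform u r s t E (kubert_model m n)"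
    using iso curve_iso_iff_transform by blast
  hence "u ^ 12 * of_int (kubert_disc m n) = disc E"
    using transform_invariants(2) disc_kubert_model by metis
  hence D: "kubert_disc m n \<noteq> 0" using E(1) by (auto simp: elliptic_curve_def)
  \<comment> \<open>This excludes the default value 1 of a product over an infinite set of bad
    primes.\<close>
  have N1: "conductor E \<noteq> 1"
    using pq(3) not_prime_unit[of p] pq(1) by (auto simp: pq(4))
  have "(m, n) \<in> {(2, 1), (1, 2), (-1, 1)}"
    by (rule kubert_model_two_bad_primes[OF D mn(1) iso mn(2-4) pq(1,2,4) N1])
  hence D_eq: "kubert_disc m n = - (2 ^ 9 * 3 ^ 5)" and C: "3 dvd kubert_c4 m n"
    and even: "even (m * n * (m - n))" and dvd3: "3 dvd m^2 - m * n + n^2"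
    by (auto simp: kubert_disc_def kubert_c4_def kubert_a1_def kubert_a2_def)
  show "min_disc E = - (2 ^ 9 * 3 ^ 5)"
    using min_disc_eqI[OF iso integral_at_kubert_model disc_kubert_model D] multiplicity_disc_less_12
    unfolding D_eq by blast
  have bad: "\<not> good_reduction 2 E" "\<not> good_reduction 3 E"
    using kubert_bad_reduction[OF _ mn(1) iso D] even dvd3 by auto
  have "\<not> multiplicative_reduction 3 E"
    using not_multiplicative_reduction_3[OF iso integral_at_kubert_model disc_kubert_model D _
        c4_kubert_model C] multiplicity_disc_less_12[of 3] unfolding D_eq by simp
  \<comment> \<open>Additive reduction contributes 2 plus a natural number, so the wild part need
    not be evaluated.\<close>
  hence "conductor_exponent 3 E \<ge> 2" using bad by (simp add: conductor_exponent_def)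
  hence "(3::nat) ^ 2 dvd 3 ^ conductor_exponent 3 E" by (rule le_imp_power_dvd)
  also have "\<dots> dvd conductor E"
    using bad_prime_power_dvd_conductor[OF N1 _ bad(2)] by simp
  finally have "3 ^ 2 dvd conductor E" .
  moreover have "2 dvd conductor E"
    using bad_prime_dvd_conductor[OF N1 _ bad(1)] by simp
  moreover have "coprime (3 ^ 2) (2::nat)" by (simp add: coprime_iff_gcd_eq_1 gcd_non_0_nat)
  ultimately have "3 ^ 2 * 2 dvd conductor E" by (rule divides_mult)
  hence "3 ^ 2 * 2 \<le> conductor E" using conductor_pos by (rule dvd_imp_le)
  thus "conductor E \<ge> 18" by simp
qed

theorem theorem3p8:
  shows "(\<forall>E. order9_two_prime_curve E \<longrightarrow>
             min_disc E = - (2 ^ 9 * 3 ^ 5) \<and>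
             \<bar>min_disc E\<bar> < int (conductor E) ^ 5) \<and>
         (\<forall>\<epsilon>::real. \<epsilon> > 0 \<longrightarrow>
             (\<exists>C::real. \<forall>E. order9_two_prime_curve E \<longrightarrow>
                real_of_int \<bar>min_disc E\<bar> \<le> C * real (conductor E) powr (6 + \<epsilon>)))"
proof (intro conjI allI impI)
  fix E assume E: "order9_two_prime_curve E"
  note disc = order9_two_prime_curve_min_disc_conductor(1)[OF E]
    and N = order9_two_prime_curve_min_disc_conductor(2)[OF E]
  show "min_disc E = - (2 ^ 9 * 3 ^ 5)" by (rule disc)
  have "\<bar>min_disc E\<bar> < 18 ^ 5" by (simp add: disc)
  also have "(18::int) ^ 5 \<le> int (conductor E) ^ 5" using N by (intro power_mono) auto
  finally show "\<bar>min_disc E\<bar> < int (conductor E) ^ 5" .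
next
  fix \<epsilon> :: real assume \<epsilon>: "\<epsilon> > 0"
  \<comment> \<open>The minimal discriminant is the same for all these curves, so its absolute value
    serves as the constant for every \<epsilon>.\<close>
  have "real_of_int \<bar>min_disc E\<bar> \<le> 2 ^ 9 * 3 ^ 5 * real (conductor E) powr (6 + \<epsilon>)"
    if E: "order9_two_prime_curve E" for E
  proof -
    have "real (conductor E) powr (6 + \<epsilon>) \<ge> 1"
      using order9_two_prime_curve_min_disc_conductor(2)[OF E] \<epsilon> by (intro ge_one_powr_ge_zero) auto
    thus ?thesis by (simp add: order9_two_prime_curve_min_disc_conductor(1)[OF E])
  qed
  thus "\<exists>C::real. \<forall>E. order9_two_prime_curve E \<longrightarrow>
      real_of_int \<bar>min_disc E\<bar> \<le> C * real (conductor E) powr (6 + \<epsilon>)" by blast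
qed

end
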